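(* Let $a>1$, $h(x)=1+ax(1-x)$ and $\nu>0$. For an integer $C\ge1$, consider the equation in $z$ $$\frac{(\nu C\,h(z))^C}{C!}-z\sum_{k=0}^{C}\frac{(\nu C\,h(z))^k}{k!}=0.\qquad(E_C)$$ Let $$\nu_a:=3\left/\left(1+\frac29a+\frac29\,\frac{(a+3)^{3/2}}{\sqrt a}\right)\right. .$$ There exists $C_0>0$ such that, for $C\ge C_0$: \begin{enumerate} \item If $\nu\in(0,1)$, then there exists a solution $x_{C,1}^*\in(0,1)$ of $(E_C)$ such that $\nu h(x_{C,1}^* )<1$ and $\lim_{C\to+\infty}x_{C,1}^*=0$. \item If $\nu\in(\nu_a,1)$, then there are three solutions $x_{C,i}^*\in(0,1)$, $i\in\{1,2,3\}$, of $(E_C)$ such that $\nu h(x_{C,1}^* )<1$ and $\nu h(x_{C,i}^* )>1$ for $i=2,3$; the limiting values, as $C\to+\infty$, of $(x_{C,2}^* )$ and $(x_{C,3}^* )$ are the two solutions in $(0,1)$ of the polynomial equation $$az^3-2az^2+(a-1)z+1=\frac1\nu,\qquad(P)$$ and $\lim_{C\to+\infty}x_{C,1}^*=0$. \item If $\nu>1$, there exists a unique solution $x_{C,1}^*\in(0,1)$ of $(E_C)$, and the sequence $(x_{C,1}^* )$ converges, as $C\to+\infty$, to the unique solution of $(P)$ in the interval $(0,1)$. \end{enumerate}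
   Context: The constant $C_0$ may depend on $a$ and $\nu$, which are fixed. Equation $(E_C)$ is the equilibrium equation for the fraction $z$ of saturated nodes in the mean-field limit of the Dynamic Alternative Routing network with node capacity $C$ and arrival rate $\lambda=\nu C$. *)

theory Defs
  imports Complex_Main
begin

definition dar_h :: "real \<Rightarrow> real \<Rightarrow> real" where
  "dar_h a x = 1 + a * x * (1 - x)"

text \<open>Equivalently, \<open>z\<close> is the Erlang blocking probability of a link of capacity \<open>C\<close>
  with offered load \<open>\<nu> * C * h z\<close>.\<close>

definition dar_equilibrium :: "real \<Rightarrow> real \<Rightarrow> nat \<Rightarrow> real \<Rightarrow> bool" where
  "dar_equilibrium a \<nu> C z \<longleftrightarrow>
     (\<nu> * real C * dar_h a z) ^ C / fact C
       - z * (\<Sum>k=0..C. (\<nu> * real C * dar_h a z) ^ k / fact k) = 0"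

text \<open>The cubic is \<open>(1 - z) * h z\<close> expanded.\<close>

definition dar_limit_equation :: "real \<Rightarrow> real \<Rightarrow> real \<Rightarrow> bool" where
  "dar_limit_equation a \<nu> z \<longleftrightarrow> a * z ^ 3 - 2 * a * z ^ 2 + (a - 1) * z + 1 = 1 / \<nu>"

text \<open>The reciprocal of the maximum of that cubic on \<open>[0, 1]\<close>.\<close>

definition nu_crit :: "real \<Rightarrow> real" where
  "nu_crit a = 3 / (1 + 2 / 9 * a + 2 / 9 * ((a + 3) powr (3 / 2) / sqrt a))"

end

theory Submission
  imports Defs "HOL-Computational_Algebra.Polynomial"
begin

text \<open>
  With \<open>u = 1 / (\<nu> h z)\<close>, the equation \<open>(E_C)\<close> reads \<open>z * S u = 1\<close>, where
  \<open>S u = \<Sum>j\<le>C. C! / ((C - j)! C^j) * u^j\<close> is the reciprocal of the Erlang blocking probability.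
  The coefficient recurrence makes \<open>S\<close> a solution of \<open>(1 - u) S = 1 - u\<^sup>2 S' / C\<close>, and since \<open>S\<close>
  and its derivatives are nonnegative this equation and its derivatives control everything.
  For \<open>u \<le> q < 1\<close> they bound \<open>S\<close>, \<open>S'\<close>, \<open>S''\<close> uniformly in \<open>C\<close>, so that \<open>(E_C)\<close> becomes
  \<open>\<nu> (1 - z) h z - 1 + O(1/C) = 0\<close> with an error of Lipschitz constant \<open>O(1/C)\<close>: near each simple
  root of the cubic there is exactly one solution. For \<open>u \<ge> 1 + d\<close> they show that \<open>S\<close> grows faster
  than \<open>C\<close>, while \<open>u S' \<le> C S\<close>; hence every solution close to \<open>0\<close> lies where \<open>z * S u\<close> is
  strictly increasing in \<open>z\<close>. In the intermediate range \<open>z * S u\<close> is at least \<open>p * S q > 1\<close>.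
\<close>

section \<open>The reciprocal Erlang polynomial\<close>

text \<open>Kept as a formal polynomial: the differential equation becomes a comparison of
  coefficients, and nonnegativity of the coefficients passes to every \<open>pderiv\<close>.\<close>

definition erlang_poly :: "nat \<Rightarrow> real poly" where
  "erlang_poly n = (\<Sum>j\<le>n. monom (fact n / (fact (n - j) * real n ^ j)) j)"

lemma coeff_erlang_poly:
  "coeff (erlang_poly n) j = (if j \<le> n then fact n / (fact (n - j) * real n ^ j) else 0)"
  by (simp add: erlang_poly_def coeff_sum)

lemma coeff_erlang_poly_0 [simp]: "coeff (erlang_poly n) 0 = 1"
  by (simp add: coeff_erlang_poly)

text \<open>At \<open>j = n\<close> the factor \<open>1 - j / n\<close> vanishes, so the recurrence
  also accounts for the end of the polynomial and holds for every \<open>j\<close>.\<close>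

lemma coeff_erlang_poly_Suc:
  assumes "n > 0"
  shows "coeff (erlang_poly n) (Suc j) = coeff (erlang_poly n) j * (1 - real j / real n)"
proof (cases "j < n")
  case True
  then obtain k where k: "n - j = Suc k" "n - Suc j = k"
    by (metis Suc_diff_Suc)
  then have "fact (n - j) = (real n - real j) * fact (n - Suc j)"
    using True by (simp add: of_nat_diff flip: of_nat_Suc)
  then show ?thesis using True assms
    by (simp add: coeff_erlang_poly divide_simps)
next
  case False
  then show ?thesis using assms by (auto simp: coeff_erlang_poly)
qed

text \<open>In degree \<open>Suc j\<close> the left side has the difference of consecutive
  coefficients, and multiplying the derivative by the square of the variable puts \<open>j\<close>
  times the \<open>j\<close>-th coefficient there; this is the recurrence again.\<close>

lemma erlang_poly_ode:
  assumes "n > 0"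
  shows "erlang_poly n * [:1, -1:] = 1 - smult (1 / real n) ([:0, 0, 1:] * pderiv (erlang_poly n))"
proof (rule poly_eqI)
  fix i
  show "coeff (erlang_poly n * [:1, -1:]) i =
      coeff (1 - smult (1 / real n) ([:0, 0, 1:] * pderiv (erlang_poly n))) i"
  proof (cases i)
    case 0
    then show ?thesis by (simp add: coeff_mult)
  next
    case (Suc j)
    then show ?thesis
      using coeff_erlang_poly_Suc[OF assms, of j]
      by (cases j) (auto simp: coeff_pderiv coeff_pCons algebra_simps add_divide_distrib)
  qed
qed

lemma poly_nonneg_coeffs_nonneg:
  fixes p :: "real poly"
  assumes "\<And>i. coeff p i \<ge> 0" "x \<ge> 0"
  shows "poly p x \<ge> 0"
  using assms by (auto simp: poly_altdef intro!: sum_nonneg)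

lemma poly_nonneg_coeffs_mono:
  fixes p :: "real poly"
  assumes "\<And>i. coeff p i \<ge> 0" "0 \<le> x" "x \<le> y"
  shows "poly p x \<le> poly p y"
  using assms by (auto simp: poly_altdef intro!: sum_mono mult_left_mono power_mono)

section \<open>Values and derivatives of the polynomial, and bounds on them\<close>

definition esum :: "nat \<Rightarrow> real \<Rightarrow> real" where
  "esum n = poly (erlang_poly n)"

definition esum' :: "nat \<Rightarrow> real \<Rightarrow> real" where
  "esum' n = poly (pderiv (erlang_poly n))"

definition esum'' :: "nat \<Rightarrow> real \<Rightarrow> real" where
  "esum'' n = poly (pderiv (pderiv (erlang_poly n)))"

definition esum''' :: "nat \<Rightarrow> real \<Rightarrow> real" where
  "esum''' n = poly (pderiv (pderiv (pderiv (erlang_poly n))))"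

lemma esum_deriv:
  "(esum n has_real_derivative esum' n x) (at x)" "(esum' n has_real_derivative esum'' n x) (at x)"
  by (simp_all add: esum_def esum'_def esum''_def poly_DERIV)

lemma coeff_erlang_poly_nonneg: "coeff (erlang_poly n) i \<ge> 0"
  by (simp add: coeff_erlang_poly)

lemma esum_nonneg: "x \<ge> 0 \<Longrightarrow> esum' n x \<ge> 0" "x \<ge> 0 \<Longrightarrow> esum'' n x \<ge> 0" "x \<ge> 0 \<Longrightarrow> esum''' n x \<ge> 0"
  by (auto simp: esum'_def esum''_def esum'''_def coeff_pderiv coeff_erlang_poly_nonneg
      intro!: poly_nonneg_coeffs_nonneg)

lemma esum_mono: "0 \<le> x \<Longrightarrow> x \<le> y \<Longrightarrow> esum n x \<le> esum n y" "0 \<le> x \<Longrightarrow> x \<le> y \<Longrightarrow> esum' n x \<le> esum' n y"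
  by (auto simp: esum_def esum'_def coeff_pderiv coeff_erlang_poly_nonneg
      intro!: poly_nonneg_coeffs_mono)

lemma esum_ge_1: "x \<ge> 0 \<Longrightarrow> esum n x \<ge> 1"
  using esum_mono(1)[of 0 x n] by (simp add: esum_def poly_0_coeff_0)

text \<open>The last two equations are formal derivatives of the first. With \<open>1 - x\<close>
  isolated on the left, each subtracted term over \<open>n\<close> is nonnegative for
  \<open>x >= 0\<close>.\<close>

lemma esum_ode:
  assumes "n > 0"
  shows "esum n x * (1 - x) = 1 - x\<^sup>2 * esum' n x / n"
    and "esum' n x * (1 - x) = esum n x - (2 * x * esum' n x + x\<^sup>2 * esum'' n x) / n"
    and "esum'' n x * (1 - x) = 2 * esum' n x - (2 * esum' n x + 4 * x * esum'' n x + x\<^sup>2 * esum''' n x) / n"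
proof -
  note e = erlang_poly_ode[OF assms]
  show "esum n x * (1 - x) = 1 - x\<^sup>2 * esum' n x / n"
    using arg_cong[OF e, of "\<lambda>p. poly p x"]
    by (simp add: esum_def esum'_def power2_eq_square algebra_simps)
  note e1 = arg_cong[OF e, of pderiv, unfolded pderiv_mult pderiv_diff pderiv_smult]
  show "esum' n x * (1 - x) = esum n x - (2 * x * esum' n x + x\<^sup>2 * esum'' n x) / n"
    using arg_cong[OF e1, of "\<lambda>p. poly p x"]
    by (simp add: esum_def esum'_def esum''_def pderiv_pCons power2_eq_square
        add_divide_distrib algebra_simps)
  note e2 = arg_cong[OF e1, of pderiv, unfolded pderiv_mult pderiv_diff pderiv_add pderiv_smult]
  show "esum'' n x * (1 - x) = 2 * esum' n x - (2 * esum' n x + 4 * x * esum'' n x + x\<^sup>2 * esum''' n x) / n"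
    using arg_cong[OF e2, of "\<lambda>p. poly p x"]
    by (simp add: esum'_def esum''_def esum'''_def pderiv_pCons power2_eq_square
        add_divide_distrib algebra_simps)
qed

text \<open>Dropping the subtracted terms in \<open>esum_ode\<close> bounds each derivative by the
  previous one, and the bounds do not depend on \<open>n\<close>.\<close>

lemma esum_upper:
  assumes "n > 0" "0 \<le> x" "x < 1"
  shows "esum n x \<le> 1 / (1 - x)" "esum' n x \<le> 1 / (1 - x) ^ 2" "esum'' n x \<le> 2 / (1 - x) ^ 3"
proof -
  have *: "esum n x * (1 - x) \<le> 1" "esum' n x * (1 - x) \<le> esum n x"
    "esum'' n x * (1 - x) \<le> 2 * esum' n x"
    unfolding esum_ode[OF assms(1)] using assms esum_nonneg[of x n] by auto
  show 0: "esum n x \<le> 1 / (1 - x)"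
    using * assms by (simp add: field_simps)
  have "esum' n x \<le> esum n x / (1 - x)"
    using * assms by (simp add: field_simps)
  also have "\<dots> \<le> (1 / (1 - x)) / (1 - x)"
    using 0 assms by (intro divide_right_mono) auto
  finally show 1: "esum' n x \<le> 1 / (1 - x) ^ 2" by (simp add: power2_eq_square)
  have "esum'' n x \<le> 2 * esum' n x / (1 - x)"
    using * assms by (simp add: field_simps)
  also have "\<dots> \<le> 2 * (1 / (1 - x) ^ 2) / (1 - x)"
    using 1 assms by (intro divide_right_mono mult_left_mono) auto
  finally show "esum'' n x \<le> 2 / (1 - x) ^ 3" by (simp add: power2_eq_square power3_eq_cube)
qed

text \<open>The equation gives \<open>x^2 S' = n (1 - S (1 - x))\<close>, which is at most
  \<open>n x S\<close> because \<open>S >= 1\<close>. This limits how fast \<open>S\<close> can fall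
  when \<open>z\<close> grows and the inverse load shrinks.\<close>

lemma esum'_le:
  assumes "n > 0" "x \<ge> 0"
  shows "x * esum' n x \<le> n * esum n x"
proof (cases "x = 0")
  case False
  have "x\<^sup>2 * esum' n x = n * (1 - esum n x * (1 - x))"
    using esum_ode(1)[OF assms(1), of x] assms(1) by (simp add: field_simps)
  also have "\<dots> \<le> n * (x * esum n x)"
    using esum_ge_1[OF assms(2), of n] by (intro mult_left_mono) (auto simp: algebra_simps)
  finally have "x * (x * esum' n x) \<le> x * (n * esum n x)"
    by (simp add: power2_eq_square algebra_simps)
  then show ?thesis using False assms by simp
qed (use esum_ge_1[of 0 n] in auto)

text \<open>Convexity: \<open>S'\<close> is nondecreasing on the nonnegative reals, so the mean
  slope is at least the slope at the left end.\<close>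

lemma esum_tangent:
  assumes "0 \<le> x" "x \<le> y"
  shows "esum n y \<ge> esum n x + (y - x) * esum' n x"
proof (cases "x = y")
  case False
  then obtain z where z: "x < z" "esum n y - esum n x = (y - x) * esum' n z"
    using MVT2[of x y "esum n" "esum' n"] assms esum_deriv(1) by (metis less_eq_real_def)
  have "(y - x) * esum' n x \<le> (y - x) * esum' n z"
    using z assms by (intro mult_left_mono esum_mono) auto
  then show ?thesis using z by simp
qed simp

text \<open>Two tangent steps of length \<open>d / 2\<close>. Since \<open>S' 1 = n\<close>, the
  first makes \<open>S\<close> at least linear in \<open>n\<close> at \<open>1 + d / 2\<close>; the
  differential equation there then makes \<open>S'\<close> at least quadratic, and the second step
  passes this on to \<open>S\<close>. Two step lengths and the factor \<open>x - 1 = d / 2\<close>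
  of the equation give the cube in the constant.\<close>

lemma esum_quadratic_growth:
  assumes "d > 0"
  shows "\<exists>k>0. \<forall>n>0. esum n (1 + d) \<ge> k * real n ^ 2"
proof (intro exI[of _ "(d/2)^3 / (1 + d/2)^2"] conjI allI impI)
  fix n :: nat
  assume n: "n > 0"
  let ?y = "1 + d / 2"
  have "esum' n 1 = n" using esum_ode(1)[OF n, of 1] n by simp
  then have 1: "esum n ?y \<ge> d / 2 * n"
    using esum_tangent[of 1 ?y n] esum_ge_1[of 1 n] assms by simp
  have step: "d / 2 * (d / 2 * n) \<le> d / 2 * esum n ?y"
    using 1 assms by (intro mult_left_mono) auto
  have "?y\<^sup>2 * esum' n ?y = n * (1 + d / 2 * esum n ?y)"
    using esum_ode(1)[OF n, of ?y] n by (simp add: field_simps)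
  also have "\<dots> \<ge> n * (d / 2 * (d / 2 * n))"
    by (rule mult_left_mono, use step in linarith) simp
  finally have 2: "esum' n ?y \<ge> n * (d / 2 * (d / 2 * n)) / ?y\<^sup>2"
    using assms by (simp add: divide_le_eq mult.commute)
  have "esum n (1 + d) \<ge> esum n ?y + d / 2 * esum' n ?y"
    using esum_tangent[of ?y "1 + d" n] assms by simp
  moreover have "d / 2 * esum' n ?y \<ge> d / 2 * (n * (d / 2 * (d / 2 * n)) / ?y\<^sup>2)"
    using 2 assms by (intro mult_left_mono) auto
  moreover have "esum n ?y \<ge> 0" using esum_ge_1[of ?y n] assms by simp
  moreover have "(d/2)^3 / ?y\<^sup>2 * real n ^ 2 = d / 2 * (n * (d / 2 * (d / 2 * n)) / ?y\<^sup>2)"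
    by (simp add: power2_eq_square power3_eq_cube)
  ultimately show "(d/2)^3 / ?y\<^sup>2 * real n ^ 2 \<le> esum n (1 + d)" by linarith
qed (use assms in auto)

text \<open>By the differential equation, \<open>1 / esum n x = 1 - x + x * erem n x\<close>.\<close>

definition erem :: "nat \<Rightarrow> real \<Rightarrow> real" where
  "erem n x = x * esum' n x / (n * esum n x)"

text \<open>\<open>erem n\<close> is \<open>x / n\<close> times the logarithmic derivative of
  \<open>S\<close>. On \<open>{0..q}\<close> the bounds of \<open>esum_upper\<close> are uniform, so
  both its size and its derivative are \<open>O(1/n)\<close>.\<close>

lemma erem_bounds:
  assumes "q < 1" "0 \<le> q"
  shows "\<exists>K>0. \<forall>n>0. \<forall>x\<in>{0..q}. \<bar>erem n x\<bar> \<le> K / n \<and>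
     (\<forall>y\<in>{0..q}. \<bar>erem n x - erem n y\<bar> \<le> K / n * \<bar>x - y\<bar>)"
proof -
  define A where "A = 1 / (1 - q)"
  have A: "A > 0" using assms by (simp add: A_def)
  \<comment> \<open>The summands bound \<open>S' / S\<close>, \<open>x S'' / S\<close> and
    \<open>x (S' / S)^2\<close> in turn, using \<open>S >= 1\<close> and
    \<open>x <= 1\<close>.\<close>
  define K where "K = A^2 + 2 * A^3 + A^4"
  have K: "K > 0" using A by (simp add: K_def add_pos_pos)
  have up: "esum' n x \<le> A^2 \<and> esum'' n x \<le> 2 * A^3" if "n > 0" "x \<in> {0..q}" for n x
  proof -
    have "1 / (1 - x) \<le> A" using that assms by (simp add: A_def frac_le)
    moreover have "0 \<le> 1 / (1 - x)" using that assms by simp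
    ultimately have "(1 / (1 - x))^2 \<le> A^2" "(1 / (1 - x))^3 \<le> A^3"
      by (intro power_mono; simp)+
    then show ?thesis using esum_upper[of n x] that assms by (simp add: power_divide)
  qed
  have R0: "\<bar>erem n x\<bar> \<le> K / n" if n: "n > 0" and x: "x \<in> {0..q}" for n x
  proof -
    have s: "esum n x \<ge> 1" "esum' n x \<ge> 0" using esum_ge_1 esum_nonneg x by auto
    have "x * esum' n x / esum n x \<le> 1 * A^2 / 1"
      using s x up[OF n x] assms by (intro frac_le mult_mono) auto
    moreover have "x * esum' n x / esum n x \<ge> 0" using s x by simp
    moreover have "A^2 \<le> K" using A by (simp add: K_def)
    ultimately have "\<bar>x * esum' n x / esum n x\<bar> \<le> K" by simp
    then show ?thesis using n by (simp add: erem_def abs_mult field_simps)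
  qed
  have R1: "\<bar>erem n x - erem n y\<bar> \<le> K / n * \<bar>x - y\<bar>"
    if n: "n > 0" and x: "x \<in> {0..q}" and y: "y \<in> {0..q}" for n x y
  proof -
    define D where "D = (\<lambda>x. (esum' n x / esum n x + x * esum'' n x / esum n x - x * (esum' n x / esum n x)^2) / n)"
    have d: "(erem n has_real_derivative D x) (at x)" if "x \<ge> 0" for x
    proof -
      have "esum n x \<noteq> 0" using esum_ge_1[of x n] that by auto
      then have "((\<lambda>x. x * esum' n x / (n * esum n x)) has_real_derivative D x) (at x)"
        unfolding D_def using n
        by (auto intro!: derivative_eq_intros esum_deriv simp: field_simps power2_eq_square)
      then show ?thesis by (simp add: erem_def[abs_def])
    qed
    have b: "\<bar>D x\<bar> \<le> K / n" if x: "x \<in> {0..q}" for x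
    proof -
      have s: "esum n x \<ge> 1" "esum' n x \<ge> 0" "esum'' n x \<ge> 0" using esum_ge_1 esum_nonneg x by auto
      have r: "0 \<le> esum' n x / esum n x" "0 \<le> x * esum'' n x / esum n x"
        "0 \<le> x * (esum' n x / esum n x)^2"
        using s x by auto
      have r1: "esum' n x / esum n x \<le> A^2 / 1"
        using s x up[OF n x] by (intro frac_le) auto
      have r2: "x * esum'' n x / esum n x \<le> 1 * (2 * A^3) / 1"
        using s x up[OF n x] A assms by (intro frac_le mult_mono) auto
      have r3: "x * (esum' n x / esum n x)^2 \<le> 1 * (A^2)^2"
        using r1 r x assms by (intro mult_mono power_mono) auto
      have "\<bar>esum' n x / esum n x + x * esum'' n x / esum n x - x * (esum' n x / esum n x)^2\<bar> \<le> K"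
        using r r1 r2 r3 unfolding K_def abs_le_iff by (simp flip: power_mult)
      then show ?thesis using n by (simp add: D_def divide_right_mono)
    qed
    have ordered: "\<bar>erem n x - erem n y\<bar> \<le> K / n * \<bar>x - y\<bar>"
      if "x < y" "x \<in> {0..q}" "y \<in> {0..q}" for x y
    proof -
      have "\<exists>z>x. z < y \<and> erem n y - erem n x = (y - x) * D z"
        by (rule MVT2) (use that d in auto)
      then obtain z where z: "x < z" "z < y" "erem n y - erem n x = (y - x) * D z" by blast
      have "\<bar>erem n x - erem n y\<bar> = \<bar>D z\<bar> * \<bar>x - y\<bar>"
        using z by (metis abs_minus_commute abs_mult mult.commute)
      also have "\<dots> \<le> K / n * \<bar>x - y\<bar>"
        using b[of z] z that by (intro mult_right_mono) auto
      finally show ?thesis .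
    qed
    show ?thesis
      using ordered[of x y] ordered[of y x] x y
      by (cases x y rule: linorder_cases) (auto simp: abs_minus_commute)
  qed
  show ?thesis using K R0 R1 by blast
qed

section \<open>Roots of small perturbations of a monotone function\<close>

text \<open>Once \<open>K / n < d\<close>, the slope of \<open>f\<close> beats the Lipschitz
  constant of \<open>e n\<close>, so \<open>f + e n\<close> is strictly increasing and has at most
  one root. The lower slope bound also turns \<open>|f (X n)| <= K / n\<close> into a rate for
  \<open>X n - l\<close>.\<close>

lemma perturbed_root:
  fixes f :: "real \<Rightarrow> real" and e :: "nat \<Rightarrow> real \<Rightarrow> real"
  assumes ab: "a < b" and d: "d > 0"
    and inc: "\<And>x y. a \<le> x \<Longrightarrow> x \<le> y \<Longrightarrow> y \<le> b \<Longrightarrow> d * (y - x) \<le> f y - f x"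
    and cont: "continuous_on {a..b} f" "\<And>n. n > 0 \<Longrightarrow> continuous_on {a..b} (e n)"
    and sgn: "f a < 0" "0 < f b"
    and small: "\<And>n x. n > 0 \<Longrightarrow> x \<in> {a..b} \<Longrightarrow> \<bar>e n x\<bar> \<le> K / n"
    and lip: "\<And>n x y. n > 0 \<Longrightarrow> x \<in> {a..b} \<Longrightarrow> y \<in> {a..b} \<Longrightarrow> \<bar>e n x - e n y\<bar> \<le> K / n * \<bar>x - y\<bar>"
  obtains l X where "a < l" "l < b" "f l = 0"
    "\<forall>\<^sub>F n in sequentially. {z \<in> {a..b}. f z + e n z = 0} = {X n}"
    "X \<longlonglongrightarrow> l"
proof -
  obtain l where l: "a \<le> l" "l \<le> b" "f l = 0"
    using IVT'[of f a 0 b] sgn ab cont by auto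
  \<comment> \<open>For small \<open>n\<close> a root may be missing and \<open>X n\<close> is then
    arbitrary; only eventual statements about \<open>X\<close> are made.\<close>
  define X where "X n = (SOME z. z \<in> {a..b} \<and> f z + e n z = 0)" for n
  have lim: "(\<lambda>n. K / real n) \<longlonglongrightarrow> 0" by (rule lim_const_over_n)
  \<comment> \<open>\<open>K / n < d\<close> gives uniqueness; the other two inequalities keep the
    signs at the endpoints, hence existence.\<close>
  have ev: "\<forall>\<^sub>F n in sequentially. n > 0 \<and> K / n < d \<and> K / n < - f a \<and> K / n < f b"
    using d sgn by (intro eventually_conj order_tendstoD(2)[OF lim] eventually_gt_at_top) auto
  have ev': "\<forall>\<^sub>F n in sequentially. n > 0 \<and> X n \<in> {a..b} \<and> {z \<in> {a..b}. f z + e n z = 0} = {X n}"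
    using ev
  proof eventually_elim
    case (elim n)
    have "f a + e n a \<le> 0" "0 \<le> f b + e n b"
      using small[of n a] small[of n b] elim ab by (auto simp: abs_le_iff)
    then obtain z where z: "a \<le> z" "z \<le> b" "f z + e n z = 0"
      using IVT'[of "\<lambda>z. f z + e n z" a 0 b] ab cont elim by (auto intro: continuous_on_add)
    then have X: "X n \<in> {a..b} \<and> f (X n) + e n (X n) = 0"
      unfolding X_def by (metis (mono_tags, lifting) atLeastAtMost_iff someI_ex)
    have less: "f x + e n x < f y + e n y" if "a \<le> x" "x < y" "y \<le> b" for x y
    proof -
      have "K / n * \<bar>x - y\<bar> < d * (y - x)"
        using mult_strict_right_mono[of "K / n" d "y - x"] elim that by simp
      then show ?thesis
        using inc[of x y] lip[of n x y] that elim by (auto simp: abs_le_iff)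
    qed
    have "z = X n" if "z \<in> {a..b}" "f z + e n z = 0" for z
      using less[of z "X n"] less[of "X n" z] that X by (cases z "X n" rule: linorder_cases) auto
    then show ?case using X elim by auto
  qed
  have "X \<longlonglongrightarrow> l"
  proof (rule metric_tendsto_imp_tendsto[OF lim_const_over_n])
    show "\<forall>\<^sub>F n in sequentially. dist (X n) l \<le> dist (K / d / real n) 0"
      using ev'
    proof eventually_elim
      case (elim n)
      have "X n \<in> {z \<in> {a..b}. f z + e n z = 0}" using elim by blast
      then have "\<bar>f (X n)\<bar> = \<bar>e n (X n)\<bar>" by auto
      then have fX: "\<bar>f (X n)\<bar> \<le> K / n" using small[of n "X n"] elim by simp
      have "d * \<bar>X n - l\<bar> \<le> \<bar>f (X n)\<bar>"
        using inc[of l "X n"] inc[of "X n" l] l elim by (cases "l \<le> X n") auto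
      also note fX
      finally have "\<bar>X n - l\<bar> \<le> K / d / n"
        using d conjunct1[OF elim] by (simp add: field_simps)
      also have "K / d / n \<le> \<bar>K / d / n\<bar>" by (rule abs_ge_self)
      finally show ?case by (simp add: dist_real_def)
    qed
  qed
  moreover have "l \<noteq> a" "l \<noteq> b" using l sgn by auto
  moreover have "\<forall>\<^sub>F n in sequentially. {z \<in> {a..b}. f z + e n z = 0} = {X n}"
    using ev' by eventually_elim blast
  ultimately show ?thesis using that[of l X] l by simp
qed

section \<open>The equilibrium equation as a perturbed cubic\<close>

text \<open>Reversing the sum by \<open>k = n - j\<close> and factoring out its top term
  \<open>T\<close> leaves \<open>T\<close> times the polynomial at the inverse load;
  \<open>T > 0\<close> cancels.\<close>

lemma dar_equilibrium_iff_esum: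
  assumes "n > 0" "\<nu> * dar_h a z > 0"
  shows "dar_equilibrium a \<nu> n z \<longleftrightarrow> z * esum n (1 / (\<nu> * dar_h a z)) = 1"
proof -
  define y where "y = \<nu> * dar_h a z"
  have y: "y > 0" and load: "\<nu> * real n * dar_h a z = n * y" using assms by (auto simp: y_def)
  define T where "T = (real n * y) ^ n / fact n"
  have T: "T > 0" using assms y by (simp add: T_def)
  have "(\<Sum>k=0..n. (n * y) ^ k / fact k) = (\<Sum>j=0..n. (n * y) ^ (n - j) / fact (n - j))"
    by (subst sum.atLeastAtMost_rev) simp
  also have "\<dots> = (\<Sum>j=0..n. T * (fact n / (fact (n - j) * n ^ j) * (1 / y) ^ j))"
  proof (intro sum.cong refl)
    fix j assume "j \<in> {0..n}"
    then have "(n * y) ^ n = (n * y) ^ (n - j) * (n ^ j * y ^ j)"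
      by (simp flip: power_add power_mult_distrib)
    then have "T = (n * y) ^ (n - j) * (n ^ j * y ^ j) / fact n" by (simp only: T_def)
    then show "(n * y) ^ (n - j) / fact (n - j) = T * (fact n / (fact (n - j) * n ^ j) * (1 / y) ^ j)"
      using y assms by (simp add: power_one_over)
  qed
  also have "\<dots> = T * esum n (1 / y)"
    by (simp add: esum_def erlang_poly_def poly_sum poly_monom sum_distrib_left atLeast0AtMost)
  finally have "dar_equilibrium a \<nu> n z \<longleftrightarrow> T - z * (T * esum n (1 / y)) = 0"
    by (simp add: dar_equilibrium_def load T_def)
  also have "\<dots> \<longleftrightarrow> T * (1 - z * esum n (1 / y)) = 0" by (simp add: algebra_simps)
  finally show ?thesis using T by (auto simp: y_def)
qed

locale dar_network =
  fixes a \<nu> :: real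
  assumes a: "a > 1" and nu: "\<nu> > 0"
begin

definition inv_load :: "real \<Rightarrow> real" where "inv_load z = 1 / (\<nu> * dar_h a z)"

text \<open>A multiple of \<open>1 - z - u\<close> with \<open>u = inv_load z\<close>: below
  \<open>u = 1\<close> the blocking probability tends to \<open>1 - u\<close>, so the zeros are the
  limiting equilibria.\<close>

definition excess :: "real \<Rightarrow> real" where "excess z = \<nu> * (1 - z) * dar_h a z - 1"

lemma h_ge_1: "z \<in> {0..1} \<Longrightarrow> dar_h a z \<ge> 1"
  using a by (simp add: dar_h_def)

lemma inv_load_pos: "z \<in> {0..1} \<Longrightarrow> inv_load z > 0"
  using h_ge_1[of z] nu by (simp add: inv_load_def)

lemma inv_load_le: "z \<in> {0..1} \<Longrightarrow> inv_load z \<le> 1 / \<nu>"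
  using h_ge_1[of z] nu by (simp add: inv_load_def field_simps)

lemma inv_load_lipschitz:
  assumes "x \<in> {0..1}" "y \<in> {0..1}"
  shows "\<bar>inv_load x - inv_load y\<bar> \<le> a / \<nu> * \<bar>x - y\<bar>"
proof -
  note h = h_ge_1[OF assms(1)] h_ge_1[OF assms(2)]
  have "inv_load x - inv_load y = (dar_h a y - dar_h a x) / \<nu> / (dar_h a x * dar_h a y)"
    using h nu by (simp add: inv_load_def field_simps)
  also have "dar_h a y - dar_h a x = a * (1 - x - y) * (y - x)"
    by (simp add: dar_h_def algebra_simps)
  finally have "\<bar>inv_load x - inv_load y\<bar> = a * \<bar>1 - x - y\<bar> * \<bar>x - y\<bar> / \<nu> / (dar_h a x * dar_h a y)"
    using a nu h by (simp add: abs_mult abs_minus_commute)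
  also have "\<dots> \<le> a * 1 * \<bar>x - y\<bar> / \<nu> / 1"
    using a nu assms h mult_mono[of 1 "dar_h a x" 1 "dar_h a y"]
    by (intro frac_le divide_right_mono mult_mono) auto
  finally show ?thesis by simp
qed

lemma continuous_on_inv_load: "continuous_on {0..1} inv_load"
  unfolding inv_load_def using h_ge_1 nu
  by (intro continuous_intros ballI) (force simp: dar_h_def[abs_def] intro!: continuous_intros)+

lemma continuous_on_excess: "continuous_on A excess"
  unfolding excess_def dar_h_def by (intro continuous_intros)

lemma excess_eq: "z \<in> {0..1} \<Longrightarrow> excess z = (1 - z - inv_load z) / inv_load z"
  using h_ge_1[of z] nu by (simp add: inv_load_def excess_def field_simps)

lemma equilibrium_iff_esum:
  assumes "n > 0" "z \<in> {0..1}"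
  shows "dar_equilibrium a \<nu> n z \<longleftrightarrow> z * esum n (inv_load z) = 1"
  using dar_equilibrium_iff_esum[of n \<nu> a z] h_ge_1[OF assms(2)] nu assms(1)
  by (simp add: inv_load_def)

text \<open>Inserting \<open>1 / S = 1 - u + u * erem n u\<close> turns the left side into
  \<open>(1 / S - z) / u\<close>. The identity is exact, so the equilibrium equation becomes the
  cubic plus a remainder for every \<open>n > 0\<close>.\<close>

lemma excess_plus_erem:
  assumes "n > 0" "z \<in> {0..1}"
  shows "excess z + erem n (inv_load z) = (1 - z * esum n (inv_load z)) / (inv_load z * esum n (inv_load z))"
proof -
  have s: "esum n (inv_load z) \<ge> 1" using inv_load_pos[OF assms(2)] esum_ge_1 by simp
  have "inv_load z * inv_load z * esum' n (inv_load z) = n * (1 - esum n (inv_load z) * (1 - inv_load z))"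
    using esum_ode(1)[OF assms(1), of "inv_load z"] assms(1)
    by (simp add: field_simps power2_eq_square)
  then have "erem n (inv_load z) = (1 - esum n (inv_load z) * (1 - inv_load z)) / (inv_load z * esum n (inv_load z))"
    using inv_load_pos[OF assms(2)] s assms(1) by (simp add: erem_def field_simps)
  then show ?thesis
    using inv_load_pos[OF assms(2)] s unfolding excess_eq[OF assms(2)] by (simp add: field_simps)
qed

lemma equilibrium_iff_excess:
  assumes "n > 0" "z \<in> {0..1}"
  shows "dar_equilibrium a \<nu> n z \<longleftrightarrow> excess z + erem n (inv_load z) = 0"
  using equilibrium_iff_esum[OF assms] excess_plus_erem[OF assms] inv_load_pos[OF assms(2)]
    esum_ge_1[of "inv_load z" n] by auto

lemma limit_equation_iff_excess: "dar_limit_equation a \<nu> z \<longleftrightarrow> excess z = 0"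
proof -
  have "excess z = \<nu> * ((a * z ^ 3 - 2 * a * z ^ 2 + (a - 1) * z + 1) - 1 / \<nu>)"
    using nu by (simp add: excess_def dar_h_def field_simps power2_eq_square power3_eq_cube)
  then show ?thesis using nu by (auto simp: dar_limit_equation_def)
qed

section \<open>Critical points and monotonicity of the cubic\<close>

definition disc_sqrt :: real where "disc_sqrt = sqrt (a\<^sup>2 + 3 * a)"
definition peak :: real where "peak = (2 * a - disc_sqrt) / (3 * a)"
definition peak' :: real where "peak' = (2 * a + disc_sqrt) / (3 * a)"

text \<open>The derivative of the cubic is \<open>3 a z^2 - 4 a z + (a - 1)\<close>, with roots
  \<open>peak\<close> and \<open>peak'\<close>. The bound \<open>2 * a\<close>, which rests on
  \<open>a > 1\<close>, makes \<open>peak\<close> positive; the bound \<open>a\<close> puts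
  \<open>peak'\<close> beyond 1.\<close>

lemma disc_sqrt: "a < disc_sqrt" "disc_sqrt < 2 * a" "disc_sqrt\<^sup>2 = a\<^sup>2 + 3 * a"
proof -
  show "a < disc_sqrt" unfolding disc_sqrt_def using a by (intro real_less_rsqrt) auto
  have "a * 1 < a * a" using a by (intro mult_strict_left_mono) auto
  then have "a\<^sup>2 + 3 * a < (2 * a)\<^sup>2" by (simp add: power2_eq_square)
  then show "disc_sqrt < 2 * a" unfolding disc_sqrt_def using a by (intro real_less_lsqrt) auto
  show "disc_sqrt\<^sup>2 = a\<^sup>2 + 3 * a" unfolding disc_sqrt_def using a by simp
qed

lemma peak: "0 < peak" "peak < 1" "1 < peak'"
  using disc_sqrt a by (auto simp: peak_def peak'_def field_simps)

lemma excess_deriv: "(excess has_real_derivative 3 * a * \<nu> * ((z - peak) * (z - peak'))) (at z)"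
proof -
  have "(z - peak) * (z - peak') = ((3 * a * z - 2 * a)\<^sup>2 - disc_sqrt\<^sup>2) / (9 * a\<^sup>2)"
    using a by (simp add: peak_def peak'_def field_simps power2_eq_square)
  also have "\<dots> = z\<^sup>2 - 4/3 * z + (a - 1) / (3 * a)"
    unfolding disc_sqrt(3) using a by (simp add: field_simps power2_eq_square)
  finally have factored: "(z - peak) * (z - peak') = z\<^sup>2 - 4/3 * z + (a - 1) / (3 * a)" .
  have "3 * a * \<nu> * ((z - peak) * (z - peak')) = \<nu> * (3 * a * z\<^sup>2 - 4 * a * z + (a - 1))"
    unfolding factored using a by (simp add: field_simps)
  then show ?thesis unfolding excess_def dar_h_def
    by (auto intro!: derivative_eq_intros simp: algebra_simps power2_eq_square)
qed

text \<open>\<open>perturbed_root\<close> needs a slope bounded away from 0. The derivative vanishes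
  at \<open>peak\<close>, so the interval has to stop at some \<open>b < peak\<close>.\<close>

lemma excess_increasing:
  assumes "b < peak"
  shows "\<exists>d>0. \<forall>x y. 0 \<le> x \<longrightarrow> x \<le> y \<longrightarrow> y \<le> b \<longrightarrow> d * (y - x) \<le> excess y - excess x"
proof (intro exI conjI allI impI)
  let ?d = "3 * a * \<nu> * ((peak - b) * (peak' - peak))"
  show "?d > 0" using a nu assms peak by simp
  fix x y assume xy: "0 \<le> x" "x \<le> y" "y \<le> b"
  show "?d * (y - x) \<le> excess y - excess x"
  proof (cases "x = y")
    case False
    then obtain z where z: "x < z" "z < y"
      "excess y - excess x = (y - x) * (3 * a * \<nu> * ((z - peak) * (z - peak')))"
      using MVT2[of x y excess, OF _ excess_deriv] xy by auto
    have "(peak - b) * (peak' - peak) \<le> (peak - z) * (peak' - z)"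
      using z xy peak assms by (intro mult_mono) auto
    then have "?d \<le> 3 * a * \<nu> * ((z - peak) * (z - peak'))"
      using a nu by (intro mult_left_mono) (auto simp: algebra_simps)
    then show ?thesis using z xy by (metis diff_ge_0_iff_ge mult.commute mult_left_mono)
  qed simp
qed

lemma excess_decreasing:
  assumes "peak < b"
  shows "\<exists>d>0. \<forall>x y. b \<le> x \<longrightarrow> x \<le> y \<longrightarrow> y \<le> 1 \<longrightarrow> d * (y - x) \<le> excess x - excess y"
proof (intro exI conjI allI impI)
  let ?d = "3 * a * \<nu> * ((b - peak) * (peak' - 1))"
  show "?d > 0" using a nu assms peak by simp
  fix x y assume xy: "b \<le> x" "x \<le> y" "y \<le> 1"
  show "?d * (y - x) \<le> excess x - excess y"
  proof (cases "x = y")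
    case False
    then obtain z where z: "x < z" "z < y"
      "excess y - excess x = (y - x) * (3 * a * \<nu> * ((z - peak) * (z - peak')))"
      using MVT2[of x y excess, OF _ excess_deriv] xy by auto
    have "(b - peak) * (peak' - 1) \<le> (z - peak) * (peak' - z)"
      using z xy peak assms by (intro mult_mono) auto
    then have "?d \<le> - (3 * a * \<nu> * ((z - peak) * (z - peak')))"
      using a nu
      by (subst mult_minus_right[symmetric], intro mult_left_mono) (auto simp: algebra_simps)
    then have "?d * (y - x) \<le> - (3 * a * \<nu> * ((z - peak) * (z - peak'))) * (y - x)"
      using xy by (intro mult_right_mono) auto
    also have "\<dots> = excess x - excess y" using z(3) by (simp add: algebra_simps)
    finally show ?thesis .
  qed simp
qed

lemma excess_mono_left:
  assumes "0 \<le> x" "x < y" "y \<le> peak"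
  shows "excess x < excess y"
proof (rule DERIV_pos_imp_increasing_open[OF assms(2)])
  fix z assume "x < z" "z < y"
  then have "0 < (z - peak) * (z - peak')" using assms peak by (intro mult_neg_neg) auto
  then have "0 < 3 * a * \<nu> * ((z - peak) * (z - peak'))" using a nu by simp
  then show "\<exists>D. (excess has_real_derivative D) (at z) \<and> 0 < D" using excess_deriv by blast
qed (rule continuous_on_excess)

lemma excess_mono_right:
  assumes "peak \<le> x" "x < y" "y \<le> 1"
  shows "excess y < excess x"
proof (rule DERIV_neg_imp_decreasing_open[OF assms(2)])
  fix z assume "x < z" "z < y"
  then have "(z - peak) * (z - peak') < 0" using assms peak by (intro mult_pos_neg) auto
  then have "3 * a * \<nu> * ((z - peak) * (z - peak')) < 0" using a nu by (simp add: mult_pos_neg)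
  then show "\<exists>D. (excess has_real_derivative D) (at z) \<and> D < 0" using excess_deriv by blast
qed (rule continuous_on_excess)

text \<open>Makes \<open>nu_crit\<close> the threshold at which the maximum of \<open>excess\<close>
  becomes positive. In \<open>w = 1 - peak\<close> the critical point equation reads
  \<open>3 a w^2 = 2 a w + 1\<close>, which reduces the cubic at \<open>peak\<close> to a linear
  expression in \<open>w\<close>.\<close>

lemma excess_peak: "excess peak = \<nu> / nu_crit a - 1"
proof -
  define w where "w = (a + disc_sqrt) / (3 * a)"
  have w: "1 - peak = w" "peak = 1 - w" using a by (auto simp: w_def peak_def field_simps)
  have "(3 * a * w - a)\<^sup>2 = a\<^sup>2 + 3 * a" using disc_sqrt(3) a by (simp add: w_def)
  then have scaled: "3 * a * (3 * (a * (w * w))) = 3 * a * (2 * a * w + 1)"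
    by (simp add: power2_eq_square algebra_simps)
  have "3 * (a * (w * w)) = 2 * a * w + 1"
    by (rule mult_left_cancel[of "3 * a", THEN iffD1, OF _ scaled]) (use a in simp)
  then have w2: "a * (w * w) = (2 * a * w + 1) / 3"
    by (metis nonzero_mult_div_cancel_left zero_neq_numeral)
  have "a * (w * w * w) = a * (w * w) * w" by simp
  also have "\<dots> = (2 * a * w + 1) / 3 * w" by (simp only: w2)
  also have "\<dots> = (2 * (a * (w * w)) + w) / 3" by (simp add: field_simps)
  finally have w3: "a * (w * w * w) = (2 * (a * (w * w)) + w) / 3" .
  have "w * dar_h a (1 - w) = w + a * (w * w) - a * (w * w * w)"
    by (simp add: dar_h_def algebra_simps)
  also have "\<dots> = 1 / 9 + 2 * (a + 3) / 9 * w" unfolding w3 w2 by (simp add: field_simps)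
  also have "\<dots> = (1 + 2/9 * a + 2/9 * ((a + 3) * disc_sqrt / a)) / 3"
    using a by (simp add: w_def field_simps)
  also have "(a + 3) * disc_sqrt / a = (a + 3) powr (3/2) / sqrt a"
  proof -
    have "disc_sqrt = sqrt a * sqrt (a + 3)"
      by (simp add: disc_sqrt_def flip: real_sqrt_mult) (simp add: power2_eq_square algebra_simps)
    moreover have "(a + 3) powr (3/2) = (a + 3) * sqrt (a + 3)"
      using a powr_add[of "a + 3" 1 "1/2"] by (simp add: powr_half_sqrt)
    ultimately have "(a + 3) * disc_sqrt / a = (a + 3) powr (3/2) * (sqrt a / a)" by simp
    also have "sqrt a / a = 1 / sqrt a" using a by (simp add: sqrt_divide_self_eq inverse_eq_divide)
    finally show ?thesis by simp
  qed
  finally have "w * dar_h a (1 - w) = 1 / nu_crit a" by (simp add: nu_crit_def)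
  then show ?thesis by (simp add: excess_def w(1) mult.assoc) (simp add: w)
qed

section \<open>Counting the solutions\<close>

lemma erem_inv_load_bounds:
  assumes "A \<subseteq> {0..1}" "\<And>z. z \<in> A \<Longrightarrow> inv_load z \<le> q" "q < 1"
  shows "\<exists>K>0. \<forall>n>0. \<forall>x\<in>A. \<bar>erem n (inv_load x)\<bar> \<le> K / n \<and>
     (\<forall>y\<in>A. \<bar>erem n (inv_load x) - erem n (inv_load y)\<bar> \<le> K / n * \<bar>x - y\<bar>)"
proof (cases "A = {}")
  case True
  then show ?thesis by (auto intro: exI[of _ 1])
next
  case False
  then obtain z where "z \<in> A" by blast
  then have "0 \<le> q" using inv_load_pos[of z] assms(1,2) by force
  then obtain K where K: "K > 0"
    "\<And>n x. n > 0 \<Longrightarrow> x \<in> {0..q} \<Longrightarrow> \<bar>erem n x\<bar> \<le> K / n"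
    "\<And>n x y. n > 0 \<Longrightarrow> x \<in> {0..q} \<Longrightarrow> y \<in> {0..q} \<Longrightarrow> \<bar>erem n x - erem n y\<bar> \<le> K / n * \<bar>x - y\<bar>"
    using erem_bounds[OF assms(3)] by blast
  have uA: "inv_load x \<in> {0..q}" if "x \<in> A" for x
    using inv_load_pos[of x] assms(1,2) that by force
  show ?thesis
  \<comment> \<open>The summand 1 serves the size bound; \<open>a / \<nu>\<close> is the Lipschitz
    constant of \<open>inv_load\<close>.\<close>
  proof (intro exI[of _ "K * (1 + a / \<nu>)"] conjI allI impI ballI)
    show "K * (1 + a / \<nu>) > 0" using K a nu by (simp add: add_pos_pos)
    fix n :: nat and x assume n: "n > 0" and x: "x \<in> A"
    have "K * 1 / n \<le> K * (1 + a / \<nu>) / n"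
      using K a nu by (intro divide_right_mono mult_left_mono) auto
    then show "\<bar>erem n (inv_load x)\<bar> \<le> K * (1 + a / \<nu>) / n"
      using K(2)[OF n uA[OF x]] by simp
    fix y assume y: "y \<in> A"
    have "\<bar>erem n (inv_load x) - erem n (inv_load y)\<bar> \<le> K / n * \<bar>inv_load x - inv_load y\<bar>"
      using K(3)[OF n uA[OF x] uA[OF y]] .
    also have "\<dots> \<le> K / n * ((1 + a / \<nu>) * \<bar>x - y\<bar>)"
      using inv_load_lipschitz[OF subsetD[OF assms(1) x] subsetD[OF assms(1) y]] K(1)
      by (intro mult_left_mono) (auto simp: distrib_right)
    finally show "\<bar>erem n (inv_load x) - erem n (inv_load y)\<bar> \<le> K * (1 + a / \<nu>) / n * \<bar>x - y\<bar>"
      by (simp add: field_simps)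
  qed
qed

lemma continuous_on_erem_inv_load:
  assumes "n > 0" "A \<subseteq> {0..1}"
  shows "continuous_on A (\<lambda>z. erem n (inv_load z))"
proof (rule continuous_on_compose2[of "{0<..}" "erem n"])
  have "real n * esum n x \<noteq> 0" if "x \<in> {0<..}" for x
    using esum_ge_1[of x n] that assms by auto
  then show "continuous_on {0<..} (erem n)"
    unfolding erem_def esum_def esum'_def by (intro continuous_intros) auto
  show "continuous_on A inv_load"
    using continuous_on_inv_load assms(2) by (rule continuous_on_subset)
  show "inv_load ` A \<subseteq> {0<..}" using inv_load_pos assms(2) by auto
qed

lemma unique_root_left_of_peak:
  assumes "0 \<le> \<alpha>" "\<alpha> < b" "b < peak" "\<And>z. z \<in> {\<alpha>..b} \<Longrightarrow> inv_load z \<le> q" "q < 1" "excess \<alpha> < 0"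
    "excess b > 0"
  obtains l X where "\<alpha> < l" "l < b" "excess l = 0"
    "\<forall>\<^sub>F n in sequentially. {z \<in> {\<alpha>..b}. excess z + erem n (inv_load z) = 0} = {X n}" "X \<longlonglongrightarrow> l"
proof -
  have sub: "{\<alpha>..b} \<subseteq> {0..1}" using assms peak by auto
  obtain d where d: "d > 0" "\<And>x y. 0 \<le> x \<Longrightarrow> x \<le> y \<Longrightarrow> y \<le> b \<Longrightarrow> d * (y - x) \<le> excess y - excess x"
    using excess_increasing[OF assms(3)] by blast
  obtain K where K: "K > 0" "\<And>n x. n > 0 \<Longrightarrow> x \<in> {\<alpha>..b} \<Longrightarrow> \<bar>erem n (inv_load x)\<bar> \<le> K / n"
    "\<And>n x y. n > 0 \<Longrightarrow> x \<in> {\<alpha>..b} \<Longrightarrow> y \<in> {\<alpha>..b} \<Longrightarrow> \<bar>erem n (inv_load x) - erem n (inv_load y)\<bar> \<le> K / n * \<bar>x - y\<bar>"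
    using erem_inv_load_bounds[OF sub assms(4,5)] by metis
  obtain l X where "\<alpha> < l" "l < b" "excess l = 0"
    "\<forall>\<^sub>F n in sequentially. {z \<in> {\<alpha>..b}. excess z + erem n (inv_load z) = 0} = {X n}" "X \<longlonglongrightarrow> l"
  proof (rule perturbed_root[of \<alpha> b d excess "\<lambda>n z. erem n (inv_load z)" K])
    show "d * (y - x) \<le> excess y - excess x" if "\<alpha> \<le> x" "x \<le> y" "y \<le> b" for x y
      using d(2)[of x y] that assms(1) by simp
  qed (use assms d K continuous_on_excess continuous_on_erem_inv_load[OF _ sub] in auto)
  then show ?thesis by (rule that)
qed

lemma unique_root_right_of_peak:
  assumes "peak < b" "b < \<beta>" "\<beta> \<le> 1" "\<And>z. z \<in> {b..\<beta>} \<Longrightarrow> inv_load z \<le> q" "q < 1" "excess b > 0"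
    "excess \<beta> < 0"
  obtains l X where "b < l" "l < \<beta>" "excess l = 0"
    "\<forall>\<^sub>F n in sequentially. {z \<in> {b..\<beta>}. excess z + erem n (inv_load z) = 0} = {X n}" "X \<longlonglongrightarrow> l"
proof -
  have sub: "{b..\<beta>} \<subseteq> {0..1}" using assms peak by auto
  obtain d where d: "d > 0" "\<And>x y. b \<le> x \<Longrightarrow> x \<le> y \<Longrightarrow> y \<le> 1 \<Longrightarrow> d * (y - x) \<le> excess x - excess y"
    using excess_decreasing[OF assms(1)] by blast
  obtain K where K: "K > 0" "\<And>n x. n > 0 \<Longrightarrow> x \<in> {b..\<beta>} \<Longrightarrow> \<bar>erem n (inv_load x)\<bar> \<le> K / n"
    "\<And>n x y. n > 0 \<Longrightarrow> x \<in> {b..\<beta>} \<Longrightarrow> y \<in> {b..\<beta>} \<Longrightarrow> \<bar>erem n (inv_load x) - erem n (inv_load y)\<bar> \<le> K / n * \<bar>x - y\<bar>"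
    using erem_inv_load_bounds[OF sub assms(4,5)] by metis
  \<comment> \<open>Negating both terms makes the decreasing branch increasing without changing the
    roots.\<close>
  have eq: "{z \<in> {b..\<beta>}. - excess z + - erem n (inv_load z) = 0} =
      {z \<in> {b..\<beta>}. excess z + erem n (inv_load z) = 0}" for n
    by auto
  obtain l X where "b < l" "l < \<beta>" "- excess l = 0"
    "\<forall>\<^sub>F n in sequentially. {z \<in> {b..\<beta>}. - excess z + - erem n (inv_load z) = 0} = {X n}" "X \<longlonglongrightarrow> l"
  proof (rule perturbed_root[of b \<beta> d "\<lambda>z. - excess z" "\<lambda>n z. - erem n (inv_load z)" K])
    show "d * (y - x) \<le> - excess y - - excess x" if "b \<le> x" "x \<le> y" "y \<le> \<beta>" for x y
      using d(2)[of x y] that assms(3) by simp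
    show "\<bar>- erem n (inv_load x) - - erem n (inv_load y)\<bar> \<le> K / n * \<bar>x - y\<bar>"
      if "n > 0" "x \<in> {b..\<beta>}" "y \<in> {b..\<beta>}" for n x y
      using K(3)[OF that] by (simp add: abs_minus_commute)
  qed (use assms d K(2) continuous_on_excess continuous_on_erem_inv_load[OF _ sub]
      in \<open>auto intro: continuous_on_minus\<close>)
  then show ?thesis using that[of l X] unfolding eq by simp
qed

text \<open>Here \<open>S\<close> is at least \<open>k n^2\<close>, so a solution is at most
  \<open>1 / (k n^2)\<close>. The derivative of \<open>z * S (u z)\<close> is at least
  \<open>S * (1 - a n z)\<close>, because \<open>u S' <= n S\<close> and \<open>h' / h <= a\<close>;
  it is positive up to any solution, so two solutions cannot coexist. Linear growth of
  \<open>S\<close> would not suffice for this.\<close>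

lemma root_near_zero:
  assumes "\<nu> < 1"
  shows "\<exists>p X. 0 < p \<and> p < 1 \<and> (\<forall>z\<in>{0..p}. inv_load z > 1) \<and>
    (\<forall>\<^sub>F n in sequentially. {z \<in> {0<..p}. z * esum n (inv_load z) = 1} = {X n}) \<and> X \<longlonglongrightarrow> 0"
proof -
  \<comment> \<open>Chosen so that \<open>\<nu> * dar_h a z <= (1 + \<nu>) / 2\<close> on
    \<open>{0..p}\<close>, that is, \<open>inv_load z >= 1 + d\<close>; the bound
    \<open>1 / 2\<close> keeps \<open>p < 1\<close>.\<close>
  define p where "p = min (1 / 2) ((1 / \<nu> - 1) / (2 * a))"
  define d where "d = 2 / (1 + \<nu>) - 1"
  have p: "0 < p" "p < 1" "2 * a * p \<le> 1 / \<nu> - 1"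
    using assms nu a by (auto simp: p_def min_def field_simps)
  have d: "d > 0" using assms nu by (simp add: d_def field_simps)
  have u_ge: "inv_load z \<ge> 1 + d" if "z \<in> {0..p}" for z
  proof -
    have "a * z * (1 - z) \<le> a * p * 1" using that p a by (intro mult_mono) auto
    then have "dar_h a z \<le> 1 + (1 / \<nu> - 1) / 2" using p by (simp add: dar_h_def)
    also have "\<dots> = (1 + \<nu>) / (2 * \<nu>)" using nu by (simp add: field_simps)
    finally have "\<nu> * dar_h a z \<le> (1 + \<nu>) / 2" using nu by (simp add: field_simps)
    moreover have "\<nu> * dar_h a z > 0" using h_ge_1[of z] that p nu by simp
    ultimately show ?thesis using nu by (simp add: inv_load_def d_def field_simps)
  qed
  obtain k where k: "k > 0" "\<And>n. n > 0 \<Longrightarrow> esum n (1 + d) \<ge> k * real n ^ 2"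
    using esum_quadratic_growth[OF d] by blast
  define X where "X n = (SOME z. z \<in> {0<..p} \<and> z * esum n (inv_load z) = 1)" for n
  have lim: "(\<lambda>n. c / real n) \<longlonglongrightarrow> 0" for c by (rule lim_const_over_n)
  \<comment> \<open>The first inequality lifts \<open>z * S (u z)\<close> above 1 at
    \<open>z = p\<close>, for existence; the second makes \<open>a n z < 1\<close> at solutions, for
    uniqueness.\<close>
  have "\<forall>\<^sub>F n in sequentially. n > 0 \<and> (1 / (k * p)) / n < 1 \<and> (a / k) / n < 1"
    by (intro eventually_conj order_tendstoD(2)[OF lim] eventually_gt_at_top) auto
  then have ev: "\<forall>\<^sub>F n in sequentially. {z \<in> {0<..p}. z * esum n (inv_load z) = 1} = {X n} \<and>
      \<bar>X n\<bar> \<le> \<bar>(1 / k) / n\<bar>"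
  proof eventually_elim
    case (elim n)
    then have n: "n > 0" "real n \<ge> 1" by auto
    have large: "z * esum n (inv_load z) \<ge> z * (k * real n ^ 2)" if "z \<in> {0..p}" for z
      using u_ge[OF that] that k(2)[OF n(1)] esum_mono(1)[of "1 + d" "inv_load z" n] d
      by (intro mult_left_mono) auto
    have small: "z \<le> 1 / (k * real n ^ 2)" if "z \<in> {0..p}" "z * esum n (inv_load z) = 1" for z
      using large[OF that(1)] that(2) k(1) n by (simp add: field_simps)
    have "p * (k * real n ^ 2) \<ge> p * (k * (real n * 1))"
      using n p k unfolding power2_eq_square by (intro mult_left_mono) auto
    moreover have "p * (k * (real n * 1)) > 1" using elim k p n by (simp add: field_simps)
    moreover have "p * (k * real n ^ 2) \<le> p * esum n (inv_load p)" using p by (intro large) auto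
    ultimately have "p * esum n (inv_load p) \<ge> 1" by linarith
    moreover have "continuous_on {0..p} (\<lambda>z. z * esum n (inv_load z))"
      unfolding esum_def
        using p by (intro continuous_intros continuous_on_subset[OF continuous_on_inv_load]) auto
    ultimately obtain z where z: "0 \<le> z" "z \<le> p" "z * esum n (inv_load z) = 1"
      using IVT'[of "\<lambda>z. z * esum n (inv_load z)" 0 1 p] p by auto
    then have "z \<in> {0<..p} \<and> z * esum n (inv_load z) = 1" by (cases "z = 0") auto
    then have X: "X n \<in> {0<..p} \<and> X n * esum n (inv_load (X n)) = 1"
      unfolding X_def by (rule someI)
    \<comment> \<open>Taking \<open>y\<close> to be a solution makes every \<open>t <= y\<close> as
      small as \<open>1 / (k n^2)\<close>; monotonicity on all of \<open>{0..p}\<close> is not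
      claimed.\<close>
    have less: "x * esum n (inv_load x) < y * esum n (inv_load y)"
      if "0 < x" "x < y" "y \<le> p" "y * esum n (inv_load y) = 1" for x y
    proof (rule DERIV_pos_imp_increasing[OF that(2)])
      fix t assume t: "x \<le> t" "t \<le> y"
      have t01: "t \<in> {0..1}" "0 < t" using t that p by auto
      note h = h_ge_1[OF t01(1)]
      let ?h' = "a * (1 - 2 * t)"
      have s: "esum n (inv_load t) \<ge> 1" "esum' n (inv_load t) \<ge> 0" "inv_load t > 0"
        using esum_ge_1 esum_nonneg(1) inv_load_pos[OF t01(1)] by auto
      have "(dar_h a has_real_derivative ?h') (at t)"
        unfolding dar_h_def by (auto intro!: derivative_eq_intros simp: algebra_simps)
      then have "(inv_load has_real_derivative - inv_load t * (?h' / dar_h a t)) (at t)"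
        unfolding inv_load_def using h nu
        by (auto intro!: derivative_eq_intros simp: divide_simps)
      then have D: "((\<lambda>z. z * esum n (inv_load z)) has_real_derivative
          (esum n (inv_load t) + t * (esum' n (inv_load t) * (- inv_load t * (?h' / dar_h a t))))) (at t)"
        by (auto intro!: derivative_eq_intros DERIV_chain2[OF esum_deriv(1)])
      have "t \<le> 1 / (k * real n ^ 2)" using small[of y] that t by auto
      then have "t * real n * a \<le> 1 / (k * real n ^ 2) * real n * a"
        using a by (intro mult_right_mono) auto
      also have "\<dots> = (a / k) / n" using k n by (simp add: field_simps power2_eq_square)
      also have "\<dots> < 1" using elim by simp
      finally have tna: "t * real n * a < 1" .
      have "?h' / dar_h a t \<le> a / 1"
        using h a t01 by (intro frac_le) auto
      then have "t * (inv_load t * esum' n (inv_load t)) * (?h' / dar_h a t)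
          \<le> t * (inv_load t * esum' n (inv_load t)) * a"
        using s t01 by (intro mult_left_mono) auto
      also have "\<dots> \<le> t * (n * esum n (inv_load t)) * a"
        using esum'_le[OF n(1), of "inv_load t"] s t01 a
        by (intro mult_left_mono mult_right_mono) auto
      also have "\<dots> = (t * n * a) * esum n (inv_load t)" by simp
      also have "\<dots> < 1 * esum n (inv_load t)" using tna s by (intro mult_strict_right_mono) auto
      finally have "0 < esum n (inv_load t) + t * (esum' n (inv_load t) * (- inv_load t * (?h' / dar_h a t)))"
        by (simp add: mult_ac)
      then show "\<exists>D. ((\<lambda>z. z * esum n (inv_load z)) has_real_derivative D) (at t) \<and> 0 < D"
        using D by blast
    qed
    have "w = X n" if "w \<in> {0<..p}" "w * esum n (inv_load w) = 1" for w
      using less[of w "X n"] less[of "X n" w] that X by (cases w "X n" rule: linorder_cases) auto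
    then have "{z \<in> {0<..p}. z * esum n (inv_load z) = 1} = {X n}" using X by blast
    moreover have "\<bar>X n\<bar> \<le> \<bar>(1 / k) / n\<bar>"
    proof -
      have "X n \<le> 1 / (k * real n ^ 2)" using small[of "X n"] X by auto
      also have "\<dots> \<le> 1 / (k * (real n * 1))"
        using k n unfolding power2_eq_square by (intro divide_left_mono mult_left_mono) auto
      finally show ?thesis using X k n by simp
    qed
    ultimately show ?case ..
  qed
  have "X \<longlonglongrightarrow> 0"
    by (rule metric_tendsto_imp_tendsto[OF lim[of "1 / k"]])
      (use ev in eventually_elim, simp add: dist_real_def)
  moreover have "\<forall>\<^sub>F n in sequentially. {z \<in> {0<..p}. z * esum n (inv_load z) = 1} = {X n}"
    using ev by eventually_elim blast
  moreover have "inv_load z > 1" if "z \<in> {0..p}" for z using u_ge[OF that] d by simp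
  ultimately show ?thesis using p by blast
qed

section \<open>The three regimes of the arrival rate\<close>

lemma excess_0: "excess 0 = \<nu> - 1" and excess_1: "excess 1 = - 1"
  by (simp_all add: excess_def dar_h_def)

lemma inv_load_less_1_iff: "z \<in> {0..1} \<Longrightarrow> inv_load z < 1 \<longleftrightarrow> \<nu> * dar_h a z > 1"
  and inv_load_greater_1_iff: "z \<in> {0..1} \<Longrightarrow> inv_load z > 1 \<longleftrightarrow> \<nu> * dar_h a z < 1"
  using h_ge_1[of z] nu by (simp_all add: inv_load_def divide_simps)

lemma subcritical:
  assumes "\<nu> < 1"
  shows "\<exists>X. (\<forall>\<^sub>F n in sequentially. X n \<in> {0<..<1} \<and> dar_equilibrium a \<nu> n (X n) \<and>
           \<nu> * dar_h a (X n) < 1) \<and> X \<longlonglongrightarrow> 0"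
proof -
  obtain p X where p: "0 < p" "p < 1" "\<And>z. z \<in> {0..p} \<Longrightarrow> inv_load z > 1"
    and X: "\<forall>\<^sub>F n in sequentially. {z \<in> {0<..p}. z * esum n (inv_load z) = 1} = {X n}" "X \<longlonglongrightarrow> 0"
    using root_near_zero[OF assms] by blast
  have "\<forall>\<^sub>F n in sequentially. X n \<in> {0<..<1} \<and> dar_equilibrium a \<nu> n (X n) \<and> \<nu> * dar_h a (X n) < 1"
    using X(1) eventually_gt_at_top[of 0]
  proof eventually_elim
    case (elim n)
    then have "X n \<in> {0<..p}" "X n * esum n (inv_load (X n)) = 1" by blast+
    moreover from this have "X n \<in> {0..1}" "X n \<in> {0..p}" using p by auto
    ultimately show ?case
      using equilibrium_iff_esum[of n "X n"] elim(2) p(2) p(3)[of "X n"]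
        inv_load_greater_1_iff[of "X n"] by auto
  qed
  then show ?thesis using X(2) by blast
qed

text \<open>Cuts the interval where \<open>excess\<close> is half its maximum: beyond
  \<open>b\<close> the slope is bounded away from 0, and between \<open>peak\<close> and
  \<open>b\<close> the value is.\<close>

lemma excess_half_peak_right:
  assumes "excess peak > 0" "peak < \<beta>" "\<beta> \<le> 1" "excess \<beta> < 0"
  obtains b where "peak < b" "b < \<beta>" "excess b = excess peak / 2"
proof -
  have "\<exists>b\<ge>peak. b \<le> \<beta> \<and> excess b = excess peak / 2"
    using assms continuous_on_excess by (intro IVT2') auto
  then obtain b where "peak \<le> b" "b \<le> \<beta>" "excess b = excess peak / 2" by blast
  then show ?thesis using that[of b] assms by (cases "b = peak"; cases "b = \<beta>") auto
qed

lemma excess_half_peak_left: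
  assumes "excess peak > 0" "\<alpha> < peak" "excess \<alpha> < 0"
  obtains b where "\<alpha> < b" "b < peak" "excess b = excess peak / 2"
proof -
  have "\<exists>b\<ge>\<alpha>. b \<le> peak \<and> excess b = excess peak / 2"
    using assms continuous_on_excess by (intro IVT') auto
  then obtain b where "\<alpha> \<le> b" "b \<le> peak" "excess b = excess peak / 2" by blast
  then show ?thesis using that[of b] assms by (cases "b = peak"; cases "b = \<alpha>") auto
qed

lemma no_root_if_bounded_below:
  assumes "A \<subseteq> {0..1}" "\<And>z. z \<in> A \<Longrightarrow> inv_load z \<le> q" "q < 1" "c > 0" "\<And>z. z \<in> A \<Longrightarrow> \<bar>excess z\<bar> \<ge> c"
  shows "\<forall>\<^sub>F n in sequentially. \<forall>z\<in>A. excess z + erem n (inv_load z) \<noteq> 0"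
proof -
  obtain K where K: "\<And>n x. n > 0 \<Longrightarrow> x \<in> A \<Longrightarrow> \<bar>erem n (inv_load x)\<bar> \<le> K / n"
    using erem_inv_load_bounds[OF assms(1-3)] by metis
  have "\<forall>\<^sub>F n in sequentially. n > 0 \<and> K / n < c"
    using assms(4)
    by (intro eventually_conj eventually_gt_at_top order_tendstoD(2)[OF lim_const_over_n])
  then show ?thesis
  proof eventually_elim
    case (elim n)
    show ?case
    proof
      fix z assume "z \<in> A"
      then show "excess z + erem n (inv_load z) \<noteq> 0" using K[of n z] assms(5)[of z] elim by auto
    qed
  qed
qed

text \<open>The inverse load is at most \<open>1 / \<nu> < 1\<close> on all of
  \<open>{0..1}\<close>, so the perturbation argument covers the whole interval.
  \<open>excess\<close> starts positive, rises to \<open>peak\<close> and falls to -1, crossing 0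
  once.\<close>

lemma supercritical:
  assumes "\<nu> > 1"
  shows "\<exists>X l. (\<forall>\<^sub>F n in sequentially. {z \<in> {0<..<1}. dar_equilibrium a \<nu> n z} = {X n}) \<and>
    {z \<in> {0<..<1}. dar_limit_equation a \<nu> z} = {l} \<and> X \<longlonglongrightarrow> l"
proof -
  have f0: "excess 0 > 0" using excess_0 assms by simp
  then have fm: "excess peak > 0" using excess_mono_left[of 0 peak] peak by simp
  obtain b where b: "peak < b" "b < 1" "excess b = excess peak / 2"
    using excess_half_peak_right[OF fm peak(2)] excess_1 by auto
  have uq: "inv_load z \<le> 1 / \<nu>" if "z \<in> {b..1}" for z using inv_load_le[of z] that b peak by simp
  obtain l X where l: "b < l" "l < 1" "excess l = 0"
    and X: "\<forall>\<^sub>F n in sequentially. {z \<in> {b..1}. excess z + erem n (inv_load z) = 0} = {X n}" "X \<longlonglongrightarrow> l"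
    by (rule unique_root_right_of_peak[OF b(1,2) order_refl uq]) (use b(3) fm excess_1 assms in auto)
  have low: "min (excess 0) (excess b) \<le> excess z" if "z \<in> {0..b}" for z
    using excess_mono_left[of 0 z] excess_mono_right[of z b] that b peak
    by (cases "z = 0"; cases "z = b"; cases "z \<le> peak") auto
  have "\<forall>\<^sub>F n in sequentially. \<forall>z\<in>{0..b}. excess z + erem n (inv_load z) \<noteq> 0"
  proof (rule no_root_if_bounded_below)
    show "min (excess 0) (excess b) \<le> \<bar>excess z\<bar>"
      if "z \<in> {0..b}" for z using low[OF that] by linarith
    show "inv_load z \<le> 1 / \<nu>" if "z \<in> {0..b}" for z using inv_load_le[of z] that b by simp
  qed (use b peak fm f0 assms in auto)
  \<comment> \<open>The root interval \<open>{b..1}\<close> contains the endpoint 1, which must be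
    ruled out to stay in the open interval.\<close>
  moreover have "\<forall>\<^sub>F n in sequentially. \<forall>z\<in>{1}. excess z + erem n (inv_load z) \<noteq> 0"
    by (rule no_root_if_bounded_below[of _ "1 / \<nu>" 1]) (use inv_load_le[of 1] excess_1 assms in auto)
  ultimately have "\<forall>\<^sub>F n in sequentially. {z \<in> {0<..<1}. dar_equilibrium a \<nu> n z} = {X n}"
    using X(1) eventually_gt_at_top[of 0]
  proof eventually_elim
    case (elim n)
    have "z \<in> {0<..<1} \<and> dar_equilibrium a \<nu> n z \<longleftrightarrow> z \<in> {b..1} \<and> excess z + erem n (inv_load z) = 0" for z
      using elim(1,2) equilibrium_iff_excess[OF elim(4), of z] b peak
      by (cases "z = 1"; cases "z < b") auto
    then show ?case using elim(3) by blast
  qed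
  moreover have "z = l" if "z \<in> {0<..<1}" "excess z = 0" for z
    using excess_mono_left[of 0 z] excess_mono_right[of z l] excess_mono_right[of l z] f0 l b peak that
    by (cases "z \<le> peak"; cases z l rule: linorder_cases) auto
  then have "{z \<in> {0<..<1}. dar_limit_equation a \<nu> z} = {l}"
    using l b peak by (auto simp: limit_equation_iff_excess)
  ultimately show ?thesis using X(2) by blast
qed

text \<open>By the differential equation \<open>S q * (1 - q)\<close> differs from 1 by
  \<open>O(1/n)\<close>, as \<open>S' q\<close> is bounded.\<close>

lemma esum_lower:
  assumes "0 < q" "q < 1" "c < 1 / (1 - q)"
  shows "\<forall>\<^sub>F n in sequentially. esum n q > c"
proof -
  define K where "K = q\<^sup>2 * (1 / (1 - q)\<^sup>2)"
  have "\<forall>\<^sub>F n in sequentially. n > 0 \<and> K / n < 1 - c * (1 - q)"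
    using assms
    by (intro eventually_conj eventually_gt_at_top order_tendstoD(2)[OF lim_const_over_n])
      (simp add: field_simps)
  then show ?thesis
  proof eventually_elim
    case (elim n)
    have "q\<^sup>2 * esum' n q / n \<le> K / n"
      unfolding K_def using esum_upper(2)[of n q] elim assms
      by (intro divide_right_mono mult_left_mono) auto
    then have "c * (1 - q) < esum n q * (1 - q)"
      using esum_ode(1)[of n q] elim by simp
    then show ?case using assms by simp
  qed
qed

text \<open>\<open>{0<..p}\<close> holds one solution by \<open>root_near_zero\<close>; the
  symmetric interval from \<alpha> to \<open>1 - \<alpha>\<close>, where the inverse load is at most
  \<open>q\<close>, holds one on each side of \<open>peak\<close>; elsewhere \<open>z >= p\<close>
  and the inverse load is at least \<open>q\<close>, so \<open>z * S\<close> exceeds 1.\<close>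

lemma metastable:
  assumes "nu_crit a < \<nu>" "nu_crit a > 0" "\<nu> < 1"
  shows "\<exists>X1 X2 X3 l2 l3.
    (\<forall>\<^sub>F n in sequentially. distinct [X1 n, X2 n, X3 n] \<and>
       {z \<in> {0<..<1}. dar_equilibrium a \<nu> n z} = {X1 n, X2 n, X3 n} \<and>
       \<nu> * dar_h a (X1 n) < 1 \<and> \<nu> * dar_h a (X2 n) > 1 \<and> \<nu> * dar_h a (X3 n) > 1) \<and>
    l2 \<noteq> l3 \<and> {z \<in> {0<..<1}. dar_limit_equation a \<nu> z} = {l2, l3} \<and>
    X1 \<longlonglongrightarrow> 0 \<and> X2 \<longlonglongrightarrow> l2 \<and> X3 \<longlonglongrightarrow> l3"
proof -
  have fm: "excess peak > 0" using assms by (simp add: excess_peak)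
  obtain p X1 where p: "0 < p" "p < 1" "\<And>z. z \<in> {0..p} \<Longrightarrow> inv_load z > 1"
    and X1: "\<forall>\<^sub>F n in sequentially. {z \<in> {0<..p}. z * esum n (inv_load z) = 1} = {X1 n}" "X1 \<longlonglongrightarrow> 0"
    using root_near_zero[OF assms(3)] by blast
  \<comment> \<open>\<open>1 / (1 - q) = 2 / p\<close> exceeds \<open>1 / p\<close>, so
    \<open>p * S q > 1\<close> eventually; and \<open>q > 1 - p\<close> places \<open>peak\<close>
    inside the region of inverse load below \<open>q\<close>.\<close>
  define q where "q = 1 - p / 2"
  have q: "0 < q" "q < 1" "1 - p < q" using p by (auto simp: q_def)
  have m01: "peak \<in> {0..1}" using peak by simp
  have um: "inv_load peak < 1 - peak"
    using fm inv_load_pos[OF m01] unfolding excess_eq[OF m01] by (simp add: zero_less_divide_iff)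
  have pm: "p < peak" using p(3)[of peak] um peak by force
  have half: "inv_load (1/2) \<le> inv_load peak"
  proof -
    have "dar_h a (1/2) - dar_h a peak = a * (1/2 - peak)\<^sup>2"
      by (simp add: dar_h_def power2_eq_square algebra_simps)
    moreover have "a * (1/2 - peak)\<^sup>2 \<ge> 0" using a by simp
    ultimately have "dar_h a peak \<le> dar_h a (1/2)" by linarith
    then show ?thesis
      unfolding inv_load_def using h_ge_1[OF m01] nu by (intro divide_left_mono) auto
  qed
  have "inv_load 0 > 1" using p(1) by (intro p(3)) simp
  then have u0: "inv_load 0 \<ge> q" using q(2) by linarith
  \<comment> \<open>\<alpha> is the left crossing of the level \<open>q\<close>; as
    \<open>dar_h\<close> is symmetric about \<open>1/2\<close>, the right one is
    \<open>1 - \<alpha>\<close>.\<close>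
  have "\<exists>\<alpha>\<ge>0. \<alpha> \<le> 1/2 \<and> inv_load \<alpha> = q"
    using u0 half um pm q by (intro IVT2' continuous_on_subset[OF continuous_on_inv_load]) auto
  then obtain \<alpha> where \<alpha>: "0 \<le> \<alpha>" "\<alpha> \<le> 1/2" "inv_load \<alpha> = q" by blast
  have p\<alpha>: "p < \<alpha>" using p(3)[of \<alpha>] \<alpha> q by force
  have factor: "dar_h a z - dar_h a \<alpha> = a * ((z - \<alpha>) * (1 - \<alpha> - z))" for z
    by (simp add: dar_h_def algebra_simps)
  have inside: "inv_load z \<le> q" if "z \<in> {\<alpha>..1 - \<alpha>}" for z
  proof -
    have "a * ((z - \<alpha>) * (1 - \<alpha> - z)) \<ge> 0" using that a by simp
    then have "dar_h a \<alpha> \<le> dar_h a z" using factor[of z] by linarith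
    then show ?thesis
      unfolding \<alpha>(3)[symmetric] inv_load_def
        using h_ge_1[of \<alpha>] \<alpha> nu by (intro divide_left_mono) auto
  qed
  have outside: "inv_load z \<ge> q" if "z \<in> {0..1}" "z \<notin> {\<alpha><..<1 - \<alpha>}" for z
  proof -
    have "(z - \<alpha>) * (1 - \<alpha> - z) \<le> 0" using that \<alpha> by (auto simp: mult_le_0_iff)
    then have "a * ((z - \<alpha>) * (1 - \<alpha> - z)) \<le> 0" using a by (simp add: mult_le_0_iff)
    then have "dar_h a z \<le> dar_h a \<alpha>" using factor[of z] by linarith
    then show ?thesis
      unfolding \<alpha>(3)[symmetric] inv_load_def
        using h_ge_1[of z] that nu by (intro divide_left_mono) auto
  qed
  have m\<alpha>: "\<alpha> < peak" "peak < 1 - \<alpha>" using outside[OF m01] um pm q by force+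
  have "inv_load (1 - \<alpha>) = q" using factor[of "1 - \<alpha>"] \<alpha>(3) by (simp add: inv_load_def)
  \<comment> \<open>At both ends the inverse load is \<open>q\<close>, so the signs are those of
    \<open>1 - \<alpha> - q = p / 2 - \<alpha>\<close> and \<open>\<alpha> - q\<close>; note
    \<open>\<alpha> > p\<close> and \<open>\<alpha> <= 1/2 < q\<close>.\<close>
  then have f\<alpha>: "excess \<alpha> < 0" "excess (1 - \<alpha>) < 0"
    using excess_eq[of \<alpha>] excess_eq[of "1 - \<alpha>"] \<alpha> p\<alpha> p q by (auto simp: divide_neg_pos q_def)
  obtain b2 where b2: "\<alpha> < b2" "b2 < peak" "excess b2 = excess peak / 2"
    using excess_half_peak_left[OF fm m\<alpha>(1) f\<alpha>(1)] by metis
  obtain b3 where b3: "peak < b3" "b3 < 1 - \<alpha>" "excess b3 = excess peak / 2"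
    using excess_half_peak_right[OF fm m\<alpha>(2) _ f\<alpha>(2)] \<alpha> by auto
  have u2: "inv_load z \<le> q" if "z \<in> {\<alpha>..b2}" for z using inside[of z] that b2 m\<alpha> by simp
  obtain l2 X2 where l2: "\<alpha> < l2" "l2 < b2" "excess l2 = 0"
    and X2: "\<forall>\<^sub>F n in sequentially. {z \<in> {\<alpha>..b2}. excess z + erem n (inv_load z) = 0} = {X2 n}"
      "X2 \<longlonglongrightarrow> l2"
    by (rule unique_root_left_of_peak[OF \<alpha>(1) b2(1,2) u2 q(2) f\<alpha>(1)]) (use b2(3) fm in auto)
  have u3: "inv_load z \<le> q" if "z \<in> {b3..1 - \<alpha>}" for z using inside[of z] that b3 m\<alpha> by simp
  obtain l3 X3 where l3: "b3 < l3" "l3 < 1 - \<alpha>" "excess l3 = 0"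
    and X3: "\<forall>\<^sub>F n in sequentially. {z \<in> {b3..1 - \<alpha>}. excess z + erem n (inv_load z) = 0} = {X3 n}"
      "X3 \<longlonglongrightarrow> l3"
    by (rule unique_root_right_of_peak[OF b3(1,2) _ u3 q(2) _ f\<alpha>(2)]) (use b3(3) fm \<alpha> in auto)
  have low: "excess peak / 2 \<le> excess z" if "z \<in> {b2..b3}" for z
    using excess_mono_left[of b2 z] excess_mono_right[of z b3] that b2 b3 peak p\<alpha> p \<alpha>
    by (cases "z = b2"; cases "z = b3"; cases "z \<le> peak") auto
  have mid: "\<forall>\<^sub>F n in sequentially. \<forall>z\<in>{b2..b3}. excess z + erem n (inv_load z) \<noteq> 0"
  proof (rule no_root_if_bounded_below)
    show "excess peak / 2 \<le> \<bar>excess z\<bar>" if "z \<in> {b2..b3}" for z using low[OF that] by linarith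
    show "inv_load z \<le> q" if "z \<in> {b2..b3}" for z using inside[of z] that b2 b3 by simp
  qed (use b2 b3 \<alpha> fm q in auto)
  have "1 / p < 1 / (1 - q)" using p(1) by (simp add: q_def field_simps)
  then have "\<forall>\<^sub>F n in sequentially. esum n q > 1 / p" by (rule esum_lower[OF q(1,2)])
  with X1(1) X2(1) X3(1) mid eventually_gt_at_top[of 0]
  have "\<forall>\<^sub>F n in sequentially. distinct [X1 n, X2 n, X3 n] \<and>
       {z \<in> {0<..<1}. dar_equilibrium a \<nu> n z} = {X1 n, X2 n, X3 n} \<and>
       \<nu> * dar_h a (X1 n) < 1 \<and> \<nu> * dar_h a (X2 n) > 1 \<and> \<nu> * dar_h a (X3 n) > 1"
  proof eventually_elim
    case (elim n)
    note n = elim(5)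
    have x1: "X1 n \<in> {0<..p}" and x2: "X2 n \<in> {\<alpha>..b2}" and x3: "X3 n \<in> {b3..1 - \<alpha>}"
      using elim(1-3) by blast+
    have far: "\<not> dar_equilibrium a \<nu> n z" if z: "p \<le> z" "z \<le> 1" "z \<notin> {\<alpha><..<1 - \<alpha>}" for z
    proof -
      have z01: "z \<in> {0..1}" using z p by simp
      have "1 < p * esum n q" using elim(6) p by (simp add: field_simps)
      also have "\<dots> \<le> z * esum n (inv_load z)"
        using z z01 p q outside[OF z01 z(3)] esum_ge_1[of q n] by (intro mult_mono esum_mono) auto
      finally show ?thesis using equilibrium_iff_esum[OF n z01] by simp
    qed
    have "z \<in> {0<..<1} \<and> dar_equilibrium a \<nu> n z \<longleftrightarrow>
        z \<in> {0<..p} \<and> z * esum n (inv_load z) = 1 \<or>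
        z \<in> {\<alpha>..b2} \<and> excess z + erem n (inv_load z) = 0 \<or>
        z \<in> {b3..1 - \<alpha>} \<and> excess z + erem n (inv_load z) = 0" (is "?L \<longleftrightarrow> ?R") for z
    proof
      assume L: ?L
      then have e: "z * esum n (inv_load z) = 1" "excess z + erem n (inv_load z) = 0"
        using equilibrium_iff_esum[OF n, of z] equilibrium_iff_excess[OF n, of z] by auto
      have "z \<notin> {b2..b3}" using elim(4) e by blast
      moreover have "z \<le> p \<or> \<alpha> < z \<and> z < 1 - \<alpha>"
      proof (rule ccontr)
        assume "\<not> ?thesis"
        then show False using far[of z] L by auto
      qed
      ultimately show ?R using L e by auto
    next
      assume ?R
      then have z: "z \<in> {0<..<1}" using p \<alpha> p\<alpha> b2 b3 peak by auto
      then show ?L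
        using \<open>?R\<close> equilibrium_iff_esum[OF n, of z] equilibrium_iff_excess[OF n, of z] by auto
    qed
    then have "{z \<in> {0<..<1}. dar_equilibrium a \<nu> n z} = {X1 n} \<union> {X2 n} \<union> {X3 n}"
      unfolding elim(1-3)[symmetric] by blast
    moreover have "distinct [X1 n, X2 n, X3 n]"
      using x1 x2 x3 p\<alpha> b2 b3 by auto
    moreover have "inv_load (X1 n) > 1" "inv_load (X2 n) < 1" "inv_load (X3 n) < 1"
      using p(3)[of "X1 n"] inside[of "X2 n"] inside[of "X3 n"] x1 x2 x3 q b2 b3 by auto
    moreover have "X1 n \<in> {0..1}" "X2 n \<in> {0..1}" "X3 n \<in> {0..1}"
      using x1 x2 x3 p \<alpha> b2 b3 peak by auto
    ultimately show ?case
      using inv_load_less_1_iff inv_load_greater_1_iff by auto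
  qed
  moreover have "z = l2 \<or> z = l3" if "z \<in> {0<..<1}" "excess z = 0" for z
    using excess_mono_left[of l2 z] excess_mono_left[of z l2] excess_mono_right[of z l3] excess_mono_right[of l3 z]
      l2 l3 b2 b3 peak \<alpha> that
    by (cases "z \<le> peak"; cases z l2 rule: linorder_cases; cases z l3 rule: linorder_cases) auto
  then have "{z \<in> {0<..<1}. dar_limit_equation a \<nu> z} = {l2, l3}"
    using l2 l3 b2 b3 peak \<alpha> by (auto simp: limit_equation_iff_excess)
  moreover have "l2 \<noteq> l3" using l2 l3 b2 b3 by simp
  ultimately show ?thesis using X1(2) X2(2) X3(2) by blast
qed

end

section \<open>One threshold for all three regimes\<close>

lemma nu_crit_pos: "a > 1 \<Longrightarrow> nu_crit a > 0"
  unfolding nu_crit_def by (intro divide_pos_pos add_pos_nonneg) auto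

theorem theorem3p1:
  fixes a \<nu> :: real
  assumes "a > 1" and "\<nu> > 0"
  shows "\<exists>C0::nat. C0 > 0 \<and>
    (\<nu> \<in> {0<..<1} \<longrightarrow>
      (\<exists>x1 :: nat \<Rightarrow> real.
        (\<forall>C\<ge>C0. x1 C \<in> {0<..<1} \<and> dar_equilibrium a \<nu> C (x1 C) \<and> \<nu> * dar_h a (x1 C) < 1) \<and>
        x1 \<longlonglongrightarrow> 0)) \<and>
    (\<nu> \<in> {nu_crit a<..<1} \<longrightarrow>
      (\<exists>(x1 :: nat \<Rightarrow> real) (x2 :: nat \<Rightarrow> real) (x3 :: nat \<Rightarrow> real) (l2 :: real) (l3 :: real).
        (\<forall>C\<ge>C0. distinct [x1 C, x2 C, x3 C] \<and>
           {z \<in> {0<..<1}. dar_equilibrium a \<nu> C z} = {x1 C, x2 C, x3 C} \<and>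
           \<nu> * dar_h a (x1 C) < 1 \<and> \<nu> * dar_h a (x2 C) > 1 \<and> \<nu> * dar_h a (x3 C) > 1) \<and>
        l2 \<noteq> l3 \<and> {z \<in> {0<..<1}. dar_limit_equation a \<nu> z} = {l2, l3} \<and>
        x1 \<longlonglongrightarrow> 0 \<and> x2 \<longlonglongrightarrow> l2 \<and> x3 \<longlonglongrightarrow> l3)) \<and>
    (\<nu> > 1 \<longrightarrow>
      (\<exists>(x1 :: nat \<Rightarrow> real) (l :: real).
        (\<forall>C\<ge>C0. {z \<in> {0<..<1}. dar_equilibrium a \<nu> C z} = {x1 C}) \<and>
        {z \<in> {0<..<1}. dar_limit_equation a \<nu> z} = {l} \<and>
        x1 \<longlonglongrightarrow> l))"
  (is "\<exists>C0. C0 > 0 \<and> (_ \<longrightarrow> (\<exists>x1. (\<forall>C\<ge>C0. ?P1 C x1) \<and> ?Q1 x1)) \<and>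
    (_ \<longrightarrow> (\<exists>x1 x2 x3 l2 l3. (\<forall>C\<ge>C0. ?P2 C x1 x2 x3) \<and> ?Q2 x1 x2 x3 l2 l3)) \<and>
    (_ \<longrightarrow> (\<exists>x1 l. (\<forall>C\<ge>C0. ?P3 C x1) \<and> ?Q3 x1 l))")
proof -
  have network: "dar_network a \<nu>" by unfold_locales (use assms in auto)
  \<comment> \<open>The regime hypothesis stays inside the existential, so a threshold is available
    even when the regime does not occur, and the maximum of the three can be taken.\<close>
  have 1: "\<exists>N x1. \<nu> \<in> {0<..<1} \<longrightarrow> (\<forall>C\<ge>N. ?P1 C x1) \<and> ?Q1 x1"
    using dar_network.subcritical[OF network] unfolding eventually_sequentially by auto
  have 2: "\<exists>N x1 x2 x3 l2 l3. \<nu> \<in> {nu_crit a<..<1} \<longrightarrow> (\<forall>C\<ge>N. ?P2 C x1 x2 x3) \<and> ?Q2 x1 x2 x3 l2 l3"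
    using dar_network.metastable[OF network _ nu_crit_pos[OF assms(1)]]
    unfolding eventually_sequentially greaterThanLessThan_iff by meson
  have 3: "\<exists>N x1 l. \<nu> > 1 \<longrightarrow> (\<forall>C\<ge>N. ?P3 C x1) \<and> ?Q3 x1 l"
    using dar_network.supercritical[OF network] unfolding eventually_sequentially by meson
  obtain N1 y where N1: "\<nu> \<in> {0<..<1} \<longrightarrow> (\<forall>C\<ge>N1. ?P1 C y) \<and> ?Q1 y" using 1 by (elim exE)
  obtain N2 y1 y2 y3 l2 l3 where N2:
    "\<nu> \<in> {nu_crit a<..<1} \<longrightarrow> (\<forall>C\<ge>N2. ?P2 C y1 y2 y3) \<and> ?Q2 y1 y2 y3 l2 l3" using 2 by (elim exE)
  obtain N3 w l where N3: "\<nu> > 1 \<longrightarrow> (\<forall>C\<ge>N3. ?P3 C w) \<and> ?Q3 w l" using 3 by (elim exE)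
  define N where "N = Suc (max N1 (max N2 N3))"
  have N: "N > 0" "\<And>C. C \<ge> N \<Longrightarrow> C \<ge> N1" "\<And>C. C \<ge> N \<Longrightarrow> C \<ge> N2" "\<And>C. C \<ge> N \<Longrightarrow> C \<ge> N3"
    by (auto simp: N_def)
  have weaken: "(\<forall>C\<ge>N. P C) \<and> Q" if "(\<forall>C\<ge>M. P C) \<and> Q" "\<And>C. C \<ge> N \<Longrightarrow> C \<ge> M" for M P Q
    using that by blast
  have "\<nu> \<in> {0<..<1} \<longrightarrow> (\<exists>x1. (\<forall>C\<ge>N. ?P1 C x1) \<and> ?Q1 x1)"
    by (rule impI, rule exI[of _ y], rule weaken[OF mp[OF N1] N(2)])
  moreover have "\<nu> \<in> {nu_crit a<..<1} \<longrightarrow> (\<exists>x1 x2 x3 l2 l3. (\<forall>C\<ge>N. ?P2 C x1 x2 x3) \<and> ?Q2 x1 x2 x3 l2 l3)"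
    by (rule impI, rule exI[of _ y1], rule exI[of _ y2], rule exI[of _ y3], rule exI[of _ l2],
        rule exI[of _ l3], rule weaken[OF mp[OF N2] N(3)])
  moreover have "\<nu> > 1 \<longrightarrow> (\<exists>x1 l. (\<forall>C\<ge>N. ?P3 C x1) \<and> ?Q3 x1 l)"
    by (rule impI, rule exI[of _ w], rule exI[of _ l], rule weaken[OF mp[OF N3] N(4)])
  ultimately show ?thesis using N(1) by (intro exI[of _ N] conjI)
qed

thm_deps theorem3p1

end
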